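(* Let $\alpha=1$ and $k^d,k^t\in\mathbb{N}$. There is an instance $I$ of the relief distribution problem with $k^t$ trucks, $k^d$ drones and drone speed $\alpha=1$ such that $$\frac{\mathrm{Optimistic}(I)}{\mathrm{OPT}(I^* )}=2.$$
   Context: Relief distribution problem (RDP). $\mathbb{N}=\{1,2,\dots\}$. An instance is $I=(k^t,k^d,\alpha,G,D)$: $k^t,k^d\in\mathbb{N}$ are the numbers of trucks and drones; $\alpha>0$ is the drone speed; $G=(V,E,c)$ is a finite connected undirected graph (not necessarily complete) with $V=\{v_0\}\cup C$, where $v_0$ is the depot and $C\neq\emptyset$ is the set of non-depot nodes; edge lengths $c(i,j)>0$ satisfy the triangle inequality; $D\subseteq C$ is the set of damaged nodes, initially unknown; the status of a node is revealed when some vehicle first arrives at it. For non-adjacent $i,j$, $c(i,j)$ is the shortest-path distance. A truck needs time $c(i,j)$ to traverse an edge, a drone needs $\frac1\alpha c(i,j)$. A tour is a closed walk in $G$ starting and ending at $v_0$ (possibly of length $0$); it visits all nodes lying on it. The makespan of a family of tours is the maximum duration of a tour. Full-information optimum: $\mathrm{OPT}(I^* )$ is the minimum makespan over all families of $k^t$ truck tours and $k^d$ drone tours such that every node of $C$ is visited by some vehicle and every node of $D$ is visited by a truck ($I^*$ is the instance $I$ with $D$ known in advance). For integers $m,n\ge 0$ with $m+n\ge1$ and $W\subseteq C$, $\mathrm{TSP}_{m,n}(W)$ denotes the minimum makespan over all families of $m$ truck tours and $n$ drone tours that together visit all nodes of $W$, and $S^*_{m,n}(W)$ denotes an optimal such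 family. Policy Optimistic (deterministic; optimal families are selected by a fixed rule based only on the information available at that time, so the first-stage tours do not depend on $D$). First stage: the vehicles execute the tours of $S^*_{k^t,k^d}(C)$ and return to the depot. Let $D^d\subseteq D$ be the set of damaged nodes not visited by truck tours in this stage. Second stage (after all vehicles returned): the trucks execute $S^*_{k^t,0}(D^d)$. Its makespan is $\mathrm{Optimistic}(I)=\mathrm{TSP}_{k^t,k^d}(C)+\mathrm{TSP}_{k^t,0}(D^d)$. *)

theory Defs
  imports "Graph_Theory.Graph_Theory"
begin

text \<open>
  An undirected graph is a finite loop-free symmetric digraph whose arcs are pairs of nodes
  (locale \<open>pair_graph\<close>). The field \<open>edge_length\<close> is only meaningful on the arcs of \<open>roads\<close>.
  This record holds the part of an instance that is known from the beginning.
\<close>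

record 'v rdp_data =
  trucks :: nat
  drones :: nat
  speed :: real
  roads :: "'v pair_pre_digraph"
  edge_length :: "'v \<times> 'v \<Rightarrow> real"
  depot :: 'v

record 'v rdp_instance =
  known :: "'v rdp_data"
  damaged :: "'v set"

definition customers :: "'v rdp_data \<Rightarrow> 'v set" where
  "customers s = pverts (roads s) - {depot s}"

definition node_distance :: "'v rdp_data \<Rightarrow> 'v \<Rightarrow> 'v \<Rightarrow> ereal" where
  "node_distance s i j =
     (if (i, j) \<in> parcs (roads s) then ereal (edge_length s (i, j))
      else wf_digraph.\<mu> (with_proj (roads s)) (edge_length s) i j)"

definition rdp_data_ok :: "'v rdp_data \<Rightarrow> bool" where
  "rdp_data_ok s \<longleftrightarrow>
     1 \<le> trucks s \<and> 1 \<le> drones s \<and> 0 < speed s \<and>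
     pair_graph (roads s) \<and> Digraph_Component.connected (with_proj (roads s)) \<and>
     depot s \<in> pverts (roads s) \<and> customers s \<noteq> {} \<and>
     (\<forall>(i, j) \<in> parcs (roads s).
        0 < edge_length s (i, j) \<and> edge_length s (i, j) = edge_length s (j, i)) \<and>
     (\<forall>i \<in> pverts (roads s). \<forall>j \<in> pverts (roads s). \<forall>k \<in> pverts (roads s).
        node_distance s i k \<le> node_distance s i j + node_distance s j k)"

definition rdp_instance_ok :: "'v rdp_instance \<Rightarrow> bool" where
  "rdp_instance_ok I \<longleftrightarrow> rdp_data_ok (known I) \<and> damaged I \<subseteq> customers (known I)"

record 'v tour_family =
  truck_tours :: "('v \<times> 'v) awalk list"
  drone_tours :: "('v \<times> 'v) awalk list"

definition is_tour :: "'v rdp_data \<Rightarrow> ('v \<times> 'v) awalk \<Rightarrow> bool" where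
  "is_tour s p \<longleftrightarrow> pre_digraph.awalk (with_proj (roads s)) (depot s) p (depot s)"

definition visited :: "'v rdp_data \<Rightarrow> ('v \<times> 'v) awalk list \<Rightarrow> 'v set" where
  "visited s ps =
     (\<Union>p \<in> set ps. set (pre_digraph.awalk_verts (with_proj (roads s)) (depot s) p))"

definition tour_families :: "'v rdp_data \<Rightarrow> nat \<Rightarrow> nat \<Rightarrow> 'v tour_family set" where
  "tour_families s m n =
     {F. length (truck_tours F) = m \<and> length (drone_tours F) = n \<and>
         (\<forall>p \<in> set (truck_tours F) \<union> set (drone_tours F). is_tour s p)}"

definition makespan :: "'v rdp_data \<Rightarrow> 'v tour_family \<Rightarrow> real" where
  "makespan s F =
     Max ((\<lambda>p. wf_digraph.awalk_cost (edge_length s) p) ` set (truck_tours F) \<union>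
          (\<lambda>p. 1 / speed s * wf_digraph.awalk_cost (edge_length s) p) ` set (drone_tours F))"

definition covering_families ::
    "'v rdp_data \<Rightarrow> nat \<Rightarrow> nat \<Rightarrow> 'v set \<Rightarrow> 'v tour_family set" where
  "covering_families s m n W =
     {F \<in> tour_families s m n. W \<subseteq> visited s (truck_tours F) \<union> visited s (drone_tours F)}"

definition TSP :: "'v rdp_data \<Rightarrow> nat \<Rightarrow> nat \<Rightarrow> 'v set \<Rightarrow> real" where
  "TSP s m n W = (LEAST t. t \<in> makespan s ` covering_families s m n W)"

definition full_information_families :: "'v rdp_instance \<Rightarrow> 'v tour_family set" where
  "full_information_families I =
     {F \<in> covering_families (known I) (trucks (known I)) (drones (known I)) (customers (known I)).
        damaged I \<subseteq> visited (known I) (truck_tours F)}"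

definition OPT :: "'v rdp_instance \<Rightarrow> real" where
  "OPT I = (LEAST t. t \<in> makespan (known I) ` full_information_families I)"

text \<open>
  Optimal families need not be unique, and \<open>Optimistic\<close> depends on which one is executed.
  A selection rule \<open>S\<close> fixes the choice; it receives the known data but not the damaged set.
\<close>

type_synonym 'v selection = "'v rdp_data \<Rightarrow> nat \<Rightarrow> nat \<Rightarrow> 'v set \<Rightarrow> 'v tour_family"

definition selection_rule :: "'v selection \<Rightarrow> bool" where
  "selection_rule S \<longleftrightarrow>
     (\<forall>s m n W. rdp_data_ok s \<longrightarrow> 1 \<le> m + n \<longrightarrow> W \<subseteq> customers s \<longrightarrow>
        is_arg_min (makespan s) (\<lambda>F. F \<in> covering_families s m n W) (S s m n W))"

definition first_stage :: "'v selection \<Rightarrow> 'v rdp_data \<Rightarrow> 'v tour_family" where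
  "first_stage S s = S s (trucks s) (drones s) (customers s)"

definition missed_damaged :: "'v selection \<Rightarrow> 'v rdp_instance \<Rightarrow> 'v set" where
  "missed_damaged S I =
     damaged I - visited (known I) (truck_tours (first_stage S (known I)))"

definition Optimistic :: "'v selection \<Rightarrow> 'v rdp_instance \<Rightarrow> real" where
  "Optimistic S I =
     TSP (known I) (trucks (known I)) (drones (known I)) (customers (known I)) +
     TSP (known I) (trucks (known I)) 0 (missed_damaged S I)"

text \<open>
  The minima used above are attained: families whose makespan stays below a bound are finite
  in number, and connectedness makes every set of nodes coverable.
\<close>

lemma finite_bounded_families:
  assumes ok: "rdp_data_ok s" and mn: "1 \<le> m + n"
  shows "finite {F \<in> tour_families s m n. makespan s F \<le> B}"
proof -
  interpret G: pair_graph "roads s" using ok by (simp add: rdp_data_ok_def)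
  let ?A = "parcs (roads s)" and ?c = "edge_length s"
  have pos: "0 < ?c e" if "e \<in> ?A" for e
    using ok that by (auto simp: rdp_data_ok_def)
  have sp: "0 < speed s" using ok by (simp add: rdp_data_ok_def)
  have finA: "finite ?A" by (rule G.pair_finite_arcs)
  define d where "d = Min (insert 1 (?c ` ?A))"
  have d: "0 < d" "\<And>e. e \<in> ?A \<Longrightarrow> d \<le> ?c e"
    using finA pos by (auto simp: d_def)
  have len: "real (length p) * d \<le> wf_digraph.awalk_cost ?c p" if "set p \<subseteq> ?A" for p
    using that by (induction p) (auto simp: algebra_simps dest: d(2))
  define N where "N = nat \<lceil>max B (speed s * B) / d\<rceil>"
  define P where "P = {p. set p \<subseteq> ?A \<and> length p \<le> N}"
  have "finite P" unfolding P_def using finA by (rule finite_lists_length_le)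
  have short: "p \<in> P" if "set p \<subseteq> ?A" "wf_digraph.awalk_cost ?c p \<le> max B (speed s * B)" for p
  proof -
    have "real (length p) \<le> max B (speed s * B) / d"
      using len[OF that(1)] that(2) d(1) by (simp add: pos_le_divide_eq)
    then have "length p \<le> N" unfolding N_def by linarith
    with that(1) show ?thesis by (simp add: P_def)
  qed
  let ?L = "\<lambda>k. {ps. set ps \<subseteq> P \<and> length ps = k}"
  have "{F \<in> tour_families s m n. makespan s F \<le> B} \<subseteq>
      (\<lambda>(ts, ds). \<lparr>truck_tours = ts, drone_tours = ds\<rparr>) ` (?L m \<times> ?L n)"
  proof
    fix F :: "'a tour_family"
    assume F: "F \<in> {F \<in> tour_families s m n. makespan s F \<le> B}"
    have arcs: "set p \<subseteq> ?A" if "p \<in> set (truck_tours F) \<union> set (drone_tours F)" for p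
      using F that by (auto simp: tour_families_def is_tour_def pre_digraph.awalk_def)
    have below: "x \<le> B"
      if "x \<in> wf_digraph.awalk_cost ?c ` set (truck_tours F) \<union>
            (\<lambda>p. 1 / speed s * wf_digraph.awalk_cost ?c p) ` set (drone_tours F)" for x
      using F Max_ge[OF _ that] unfolding makespan_def by (auto intro: order_trans)
    have "wf_digraph.awalk_cost ?c p \<le> B" if "p \<in> set (truck_tours F)" for p
      using that by (intro below) blast
    then have t: "set (truck_tours F) \<subseteq> P"
      using arcs by (force intro!: short)
    have "1 / speed s * wf_digraph.awalk_cost ?c p \<le> B" if "p \<in> set (drone_tours F)" for p
      using that by (intro below) blast
    then have "wf_digraph.awalk_cost ?c p \<le> speed s * B" if "p \<in> set (drone_tours F)" for p
      using that sp by (simp add: field_simps)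
    then have d: "set (drone_tours F) \<subseteq> P"
      using arcs by (force intro!: short)
    show "F \<in> (\<lambda>(ts, ds). \<lparr>truck_tours = ts, drone_tours = ds\<rparr>) ` (?L m \<times> ?L n)"
      using t d F
      by (intro image_eqI[where x = "(truck_tours F, drone_tours F)"])
        (auto simp: tour_families_def)
  qed
  moreover have "finite (?L k)" for k using \<open>finite P\<close> by (rule finite_lists_length_eq)
  ultimately show ?thesis by (meson finite_SigmaI finite_imageI finite_subset)
qed

lemma minimal_family_exists:
  assumes ok: "rdp_data_ok s" and mn: "1 \<le> m + n"
    and X: "X \<subseteq> tour_families s m n" "X \<noteq> {}"
  obtains F where "is_arg_min (makespan s) (\<lambda>F. F \<in> X) F"
proof -
  obtain F0 where F0: "F0 \<in> X" using X by auto
  let ?Y = "{F \<in> X. makespan s F \<le> makespan s F0}"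
  have "finite ?Y"
    using finite_bounded_families[OF ok mn, of "makespan s F0"] X(1)
    by (rule_tac finite_subset) auto
  then obtain F where F: "is_arg_min (makespan s) (\<lambda>F. F \<in> ?Y) F"
    using ex_is_arg_min_if_finite[of ?Y] F0 by blast
  then have "is_arg_min (makespan s) (\<lambda>F. F \<in> X) F"
    using F0 by (force simp: is_arg_min_linorder)
  then show thesis by (rule that)
qed

lemma Least_eq_makespan:
  assumes "is_arg_min (makespan s) (\<lambda>F. F \<in> X) F"
  shows "(LEAST t. t \<in> makespan s ` X) = makespan s F"
  using assms by (intro Least_equality) (auto simp: is_arg_min_linorder)

lemma covering_tour_exists:
  assumes ok: "rdp_data_ok s" and W: "W \<subseteq> pverts (roads s)"
  obtains p where "is_tour s p" "W \<subseteq> visited s [p]"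
proof -
  interpret G: pair_graph "roads s" using ok by (simp add: rdp_data_ok_def)
  have dep: "depot s \<in> pverts (roads s)" using ok by (simp add: rdp_data_ok_def)
  have sc: "strongly_connected (with_proj (roads s))"
    using ok G.symmetric_connected_imp_strongly_connected G.pair_sym_arcs
    by (simp add: rdp_data_ok_def)
  have "finite W" using W G.pair_finite_verts by (rule finite_subset)
  then have "\<exists>p. is_tour s p \<and> W \<subseteq> visited s [p]"
    using W
  proof (induction W)
    case empty
    have "is_tour s []" using dep by (simp add: is_tour_def G.awalk_Nil_iff)
    then show ?case by auto
  next
    case (insert w W)
    then obtain p where p: "is_tour s p" "W \<subseteq> visited s [p]" by auto
    obtain q r where q: "G.awalk (depot s) q w" and r: "G.awalk w r (depot s)"
      using sc dep insert.prems unfolding strongly_connected_def G.reachable_awalk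
      by simp blast
    have p': "G.awalk (depot s) p (depot s)" using p(1) by (simp add: is_tour_def)
    have qr: "G.awalk (depot s) (q @ r) (depot s)" using q r by (rule G.awalk_appendI)
    have t: "G.awalk (depot s) (p @ q @ r) (depot s)" using p' qr by (rule G.awalk_appendI)
    have "w \<in> set (pawalk_verts (depot s) (q @ r))"
      using G.set_awalk_verts_append[OF q r] G.hd_in_awalk_verts(1)[OF r] by auto
    then have "insert w W \<subseteq> visited s [p @ q @ r]"
      using p(2) G.set_awalk_verts_append[OF p' qr]
      by (auto simp: visited_def awalk_verts_with_proj_eq)
    with t show ?case unfolding is_tour_def by blast
  qed
  then show thesis using that by blast
qed

lemma optimal_covering_family_exists:
  assumes ok: "rdp_data_ok s" and mn: "1 \<le> m + n" and W: "W \<subseteq> customers s"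
  shows "\<exists>F. is_arg_min (makespan s) (\<lambda>F. F \<in> covering_families s m n W) F \<and>
             TSP s m n W = makespan s F"
proof -
  obtain p where p: "is_tour s p" "W \<subseteq> visited s [p]"
    using covering_tour_exists[OF ok] W unfolding customers_def by blast
  have "\<lparr>truck_tours = replicate m p, drone_tours = replicate n p\<rparr> \<in> covering_families s m n W"
    using p mn by (auto simp: covering_families_def tour_families_def visited_def)
  then obtain F where "is_arg_min (makespan s) (\<lambda>F. F \<in> covering_families s m n W) F"
    using minimal_family_exists[OF ok mn, of "covering_families s m n W"]
    unfolding covering_families_def by blast
  then show ?thesis unfolding TSP_def using Least_eq_makespan by blast
qed

lemma optimal_full_information_family_exists:
  assumes ok: "rdp_instance_ok I"
  shows "\<exists>F. is_arg_min (makespan (known I)) (\<lambda>F. F \<in> full_information_families I) F \<and>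
             OPT I = makespan (known I) F"
proof -
  let ?s = "known I" and ?X = "full_information_families I"
  let ?m = "trucks ?s" and ?n = "drones ?s"
  have ok': "rdp_data_ok ?s" and D: "damaged I \<subseteq> customers ?s"
    using ok by (auto simp: rdp_instance_ok_def)
  have m: "1 \<le> ?m" using ok' by (simp add: rdp_data_ok_def)
  then have mn: "1 \<le> ?m + ?n" by simp
  obtain p where p: "is_tour ?s p" "customers ?s \<subseteq> visited ?s [p]"
    using covering_tour_exists[OF ok', of "customers ?s"] unfolding customers_def by blast
  have "\<lparr>truck_tours = replicate ?m p, drone_tours = replicate ?n p\<rparr> \<in> ?X"
    using p m D
    by (auto simp: full_information_families_def covering_families_def tour_families_def visited_def)
  then obtain F where "is_arg_min (makespan ?s) (\<lambda>F. F \<in> ?X) F"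
    using minimal_family_exists[OF ok' mn, of ?X]
    unfolding full_information_families_def covering_families_def by blast
  then show ?thesis unfolding OPT_def using Least_eq_makespan by blast
qed

lemma selection_rule_exists: "\<exists>S :: 'v selection. selection_rule S"
proof -
  define S :: "'v selection" where
    "S = (\<lambda>s m n W. SOME F. is_arg_min (makespan s) (\<lambda>F. F \<in> covering_families s m n W) F)"
  have "selection_rule S"
    unfolding selection_rule_def S_def
    using optimal_covering_family_exists by (metis (mono_tags, lifting) someI_ex)
  then show ?thesis by blast
qed

end

theory Submission
  imports Defs
begin

text \<open>
  Take the complete graph on the depot and \<open>kt + kd\<close> customers with unit edge lengths. A tour
  that serves a customer has length at least 2, and a tour of length at most 2 serves at most one
  customer. Hence the first stage takes time 2 and the trucks miss some customer. Declare exactly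
  that one damaged: the second stage takes time 2 again, whereas with full information a truck
  goes to it right away and everything is done at time 2.
\<close>

definition unit_complete_graph :: "nat \<Rightarrow> nat pair_pre_digraph" where
  "unit_complete_graph n =
     \<lparr>pverts = {..n}, parcs = {(i, j). i \<le> n \<and> j \<le> n \<and> i \<noteq> j}\<rparr>"

text \<open>One customer per vehicle: a single round trip each serves everybody, while the trucks
  alone are too few as soon as there is a drone.\<close>

definition unit_complete_data :: "nat \<Rightarrow> nat \<Rightarrow> nat rdp_data" where
  "unit_complete_data m n =
     \<lparr>trucks = m, drones = n, speed = 1, roads = unit_complete_graph (m + n),
      edge_length = (\<lambda>_. 1), depot = 0\<rparr>"

lemma unit_complete_graph_simps [simp]:
  "pverts (unit_complete_graph n) = {..n}"
  "parcs (unit_complete_graph n) = {(i, j). i \<le> n \<and> j \<le> n \<and> i \<noteq> j}"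
  by (simp_all add: unit_complete_graph_def)

lemma unit_complete_data_simps [simp]:
  "trucks (unit_complete_data m n) = m"
  "drones (unit_complete_data m n) = n"
  "speed (unit_complete_data m n) = 1"
  "roads (unit_complete_data m n) = unit_complete_graph (m + n)"
  "edge_length (unit_complete_data m n) = (\<lambda>_. 1)"
  "depot (unit_complete_data m n) = 0"
  "customers (unit_complete_data m n) = {1..m + n}"
  by (auto simp: unit_complete_data_def customers_def)

lemma pair_graph_unit_complete: "pair_graph (unit_complete_graph n)"
proof
  have "parcs (unit_complete_graph n) \<subseteq> {..n} \<times> {..n}" by auto
  then show "finite (parcs (unit_complete_graph n))" by (rule finite_subset) simp
qed (auto simp: symmetric_def sym_def)

lemma connected_unit_complete:
  "Digraph_Component.connected (with_proj (unit_complete_graph n))"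
proof -
  interpret G: pair_graph "unit_complete_graph n" by (rule pair_graph_unit_complete)
  have "u \<rightarrow>\<^sup>*\<^bsub>with_proj (unit_complete_graph n)\<^esub> v" if "u \<le> n" "v \<le> n" for u v
  proof (cases "u = v")
    case True
    then show ?thesis using that by simp
  next
    case False
    then have "(u, v) \<in> parcs (unit_complete_graph n)" using that by simp
    then show ?thesis by auto
  qed
  then show ?thesis
    by (intro G.connectedI) (auto simp: G.reachable_mk_symmetric_eq[OF G.pair_sym_arcs])
qed

lemma awalk_cost_unit_length: "wf_digraph.awalk_cost (\<lambda>_. 1) p = real (length p)"
  for p :: "(nat \<times> nat) awalk"
proof -
  \<comment> \<open>\<open>awalk_cost\<close> does not depend on the graph, so any concrete graph
    gives access to its defining equation.\<close>
  interpret G: pair_graph "unit_complete_graph 0" by (rule pair_graph_unit_complete)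
  show ?thesis by (simp add: G.awalk_cost_def sum_list_triv)
qed

lemma node_distance_unit_complete:
  assumes "i \<le> m + n" "j \<le> m + n"
  shows "node_distance (unit_complete_data m n) i j = (if i = j then 0 else 1)"
proof (cases "i = j")
  case True
  interpret G: pair_graph "unit_complete_graph (m + n)" by (rule pair_graph_unit_complete)
  \<comment> \<open>A loop is no arc, so on the diagonal \<open>node_distance\<close> is the infimum
    of walk costs; the empty walk attains 0.\<close>
  have "G.\<mu> (\<lambda>_. 1) i i \<le> 0"
    using G.min_cost_le_walk_cost[of i "[]" i "\<lambda>_. 1"] assms by (simp add: G.awalk_Nil_iff zero_ereal_def)
  moreover have "0 \<le> G.\<mu> (\<lambda>_. 1) i i"
    unfolding G.\<mu>_def by (auto intro!: INF_greatest simp: awalk_cost_unit_length)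
  ultimately show ?thesis using True by (simp add: node_distance_def)
qed (use assms in \<open>simp add: node_distance_def one_ereal_def\<close>)

text \<open>The node distances are those of the discrete metric, whence the triangle
  inequality.\<close>

lemma rdp_data_ok_unit_complete:
  assumes "1 \<le> m" "1 \<le> n"
  shows "rdp_data_ok (unit_complete_data m n)"
  using assms pair_graph_unit_complete connected_unit_complete
  by (auto simp: rdp_data_ok_def node_distance_unit_complete)

text \<open>Speed 1 removes the drone factor and unit lengths turn costs into arc counts, so trucks
  and drones enter alike.\<close>

lemma makespan_unit_complete:
  "makespan (unit_complete_data m n) F =
     Max ((\<lambda>p. real (length p)) ` (set (truck_tours F) \<union> set (drone_tours F)))"
  by (simp add: makespan_def awalk_cost_unit_length image_Un)

lemma length_le_makespan_unit_complete:
  assumes "p \<in> set (truck_tours F) \<union> set (drone_tours F)"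
  shows "real (length p) \<le> makespan (unit_complete_data m n) F"
  unfolding makespan_unit_complete using assms by (intro Max_ge) auto

text \<open>The empty tour sees only the depot, and a closed walk with one arc would be a
  loop.\<close>

lemma length_ge_2_if_visits_customer:
  assumes "is_tour (unit_complete_data m n) p" "v \<in> visited (unit_complete_data m n) [p]" "v \<noteq> 0"
  shows "2 \<le> length p"
proof (cases p)
  case Nil
  then show ?thesis using assms by (simp add: visited_def awalk_verts_with_proj_eq)
next
  case (Cons a q)
  then show ?thesis using assms
    by (cases q) (auto simp: is_tour_def pre_digraph.awalk_def cas_with_proj_eq)
qed

lemma card_customers_on_short_tour:
  assumes "is_tour (unit_complete_data m n) p" "length p \<le> 2"
  shows "card (visited (unit_complete_data m n) [p] - {0}) \<le> 1"
proof -
  \<comment> \<open>A tour with two arcs has the form 0, \<open>v\<close>, 0. Inclusion in a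
    singleton also covers the empty tour, which serves no customer.\<close>
  have "\<exists>v. visited (unit_complete_data m n) [p] - {0} \<subseteq> {v}"
  proof (cases p)
    case Nil
    then show ?thesis by (auto simp: visited_def awalk_verts_with_proj_eq)
  next
    case (Cons a q)
    then show ?thesis using assms
      by (cases q) (auto simp: is_tour_def visited_def pre_digraph.awalk_def awalk_verts_with_proj_eq
          cas_with_proj_eq)
  qed
  then show ?thesis by (metis card.empty card.insert card_mono empty_iff finite.intros One_nat_def)
qed

text \<open>Some vehicle must leave the depot and return. The fleet sizes and \<open>W\<close> are
  arbitrary so that the bound applies to both stages and to the full-information optimum.\<close>

lemma makespan_unit_complete_ge_2:
  assumes "F \<in> covering_families (unit_complete_data m n) a b W" "W \<noteq> {}" "0 \<notin> W"
  shows "2 \<le> makespan (unit_complete_data m n) F"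
proof -
  obtain v where v: "v \<in> W" "v \<noteq> 0" using assms(2,3) by (metis equals0I)
  then obtain p where p: "p \<in> set (truck_tours F) \<union> set (drone_tours F)"
    "v \<in> visited (unit_complete_data m n) [p]"
    using assms(1) by (fastforce simp: covering_families_def visited_def)
  then have "2 \<le> length p"
    using assms(1) v
    by (intro length_ge_2_if_visits_customer) (auto simp: covering_families_def tour_families_def)
  then show ?thesis
    using length_le_makespan_unit_complete[OF p(1), of m n] by linarith
qed

text \<open>Lists fix the fleet sizes by their lengths and allow several vehicles to go to the same
  customer.\<close>

definition round_trips :: "nat list \<Rightarrow> nat list \<Rightarrow> nat tour_family" where
  "round_trips xs ys =
     \<lparr>truck_tours = map (\<lambda>i. [(0, i), (i, 0)]) xs, drone_tours = map (\<lambda>i. [(0, i), (i, 0)]) ys\<rparr>"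

lemma visited_round_trips:
  assumes "1 \<le> length xs"
  shows "visited (unit_complete_data m n) (map (\<lambda>i. [(0, i), (i, 0)]) xs) = insert 0 (set xs)"
  using assms by (cases xs) (auto simp: visited_def awalk_verts_with_proj_eq)

lemma round_trips_covering:
  assumes "set xs \<union> set ys \<subseteq> {1..m + n}" "W \<subseteq> set xs \<union> set ys"
  shows "round_trips xs ys \<in>
    covering_families (unit_complete_data m n) (length xs) (length ys) W"
  using assms
  by (auto simp: covering_families_def tour_families_def round_trips_def visited_def is_tour_def
      pre_digraph.awalk_def awalk_verts_with_proj_eq cas_with_proj_eq Suc_le_eq)

lemma makespan_round_trips:
  assumes "xs \<noteq> []"
  shows "makespan (unit_complete_data m n) (round_trips xs ys) = 2"
proof -
  have "(\<lambda>p. real (length p)) `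
      (set (truck_tours (round_trips xs ys)) \<union> set (drone_tours (round_trips xs ys))) = {2}"
    using assms by (cases xs) (auto simp: round_trips_def)
  then show ?thesis by (simp add: makespan_unit_complete)
qed

text \<open>Round trips attain the lower bound 2. This yields the first stage and, with
  \<open>ys\<close> empty, the second.\<close>

lemma TSP_unit_complete:
  assumes "xs \<noteq> []" "set xs \<union> set ys \<subseteq> {1..m + n}" "W \<subseteq> set xs \<union> set ys" "W \<noteq> {}"
  shows "TSP (unit_complete_data m n) (length xs) (length ys) W = 2"
  unfolding TSP_def
proof (rule Least_equality)
  show "2 \<in> makespan (unit_complete_data m n) `
      covering_families (unit_complete_data m n) (length xs) (length ys) W"
    using round_trips_covering[OF assms(2,3)] makespan_round_trips[OF assms(1)]
    by (metis image_eqI)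
  have "0 \<notin> W" using assms(2,3) by (meson atLeastAtMost_iff not_one_le_zero subsetD)
  then show "2 \<le> t" if "t \<in> makespan (unit_complete_data m n) `
      covering_families (unit_complete_data m n) (length xs) (length ys) W" for t
    using that makespan_unit_complete_ge_2 assms(4) by blast
qed

lemma customer_enumeration:
  assumes "1 \<le> m" "d \<in> {1..m + n}"
  obtains xs ys :: "nat list"
  where "length xs = m" "length ys = n" "set xs \<union> set ys = {1..m + n}" "d \<in> set xs"
proof -
  \<comment> \<open>With \<open>d\<close> in front and \<open>1 \<le> m\<close>, the trucks' share,
    the first \<open>m\<close> entries, contains \<open>d\<close>.\<close>
  define zs where "zs = d # remove1 d [1..<Suc (m + n)]"
  have zs: "length zs = m + n" "set zs = {1..m + n}"
    using assms by (auto simp: zs_def length_remove1)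
  show thesis
  proof (rule that)
    show "set (take m zs) \<union> set (drop m zs) = {1..m + n}"
      by (simp flip: set_append add: zs(2))
    show "d \<in> set (take m zs)" using assms(1) by (cases m) (auto simp: zs_def)
  qed (use zs(1) in auto)
qed

text \<open>Union bound over the tours, each contributing at most one customer.\<close>

lemma card_customers_on_short_tours:
  assumes "\<And>p. p \<in> set ps \<Longrightarrow> is_tour (unit_complete_data m n) p \<and> length p \<le> 2"
  shows "card (visited (unit_complete_data m n) ps - {0}) \<le> length ps"
  using assms
proof (induction ps)
  case Nil
  then show ?case by (simp add: visited_def)
next
  case (Cons p ps)
  let ?V = "\<lambda>ps. visited (unit_complete_data m n) ps - {0}"
  have "?V (p # ps) = ?V [p] \<union> ?V ps" by (auto simp: visited_def)
  then have "card (?V (p # ps)) \<le> card (?V [p]) + card (?V ps)" by (simp add: card_Un_le)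
  also have "\<dots> \<le> 1 + length ps"
    using Cons card_customers_on_short_tour[of m n p] by (intro add_mono) auto
  finally show ?case by simp
qed

theorem lemma17:
  fixes kt kd :: nat and S :: "nat selection"
  assumes "1 \<le> kt" and "1 \<le> kd"
    and "selection_rule S"
  shows "\<exists>I :: nat rdp_instance.
    rdp_instance_ok I \<and>
    trucks (known I) = kt \<and> drones (known I) = kd \<and> speed (known I) = 1 \<and>
    Optimistic S I / OPT I = 2"
proof -
  let ?s = "unit_complete_data kt kd" and ?C = "{1..kt + kd}"
  have ok: "rdp_data_ok ?s" using assms(1,2) by (rule rdp_data_ok_unit_complete)
  \<comment> \<open>\<open>F\<close> is determined by \<open>S\<close> and the known data alone, so
    the damaged node may be chosen after inspecting \<open>F\<close>, whatever optimal family
    \<open>S\<close> selects.\<close>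
  define F where "F = first_stage S ?s"
  have "is_arg_min (makespan ?s) (\<lambda>F. F \<in> covering_families ?s kt kd ?C) F"
    using assms ok by (auto simp: F_def first_stage_def selection_rule_def)
  then have F: "F \<in> covering_families ?s kt kd ?C"
    and F_min: "\<And>F'. F' \<in> covering_families ?s kt kd ?C \<Longrightarrow> makespan ?s F \<le> makespan ?s F'"
    by (auto simp: is_arg_min_linorder)
  have F_le: "makespan ?s F \<le> 2"
  proof -
    \<comment> \<open>The optimal \<open>F\<close> is compared with round trips that send each
      vehicle to its own customer; the choice of customer 1 is arbitrary.\<close>
    obtain xs ys where "length xs = kt" "length ys = kd" "set xs \<union> set ys = ?C" "1 \<in> set xs"
      using customer_enumeration[of kt 1 kd] assms(1) by auto
    then show ?thesis
      using F_min[of "round_trips xs ys"] round_trips_covering[of xs ys kt kd ?C]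
        makespan_round_trips[of xs kt kd ys] by (cases "xs = []") auto
  qed
  have "length p \<le> 2" if "p \<in> set (truck_tours F)" for p
    using length_le_makespan_unit_complete[of p F kt kd] F_le that by auto
  then have "card (visited ?s (truck_tours F) - {0}) \<le> length (truck_tours F)"
    using F
    by (intro card_customers_on_short_tours) (auto simp: covering_families_def tour_families_def)
  \<comment> \<open>Pigeonhole: \<open>1 \<le> kd\<close>, so there are more customers than
    trucks.\<close>
  also have "\<dots> < card ?C"
    using F assms(2) by (simp add: covering_families_def tour_families_def)
  finally have "\<not> ?C \<subseteq> visited ?s (truck_tours F) - {0}"
    using card_mono[of "visited ?s (truck_tours F) - {0}" ?C] by (force simp: visited_def)
  then obtain d where d: "d \<in> ?C" "d \<notin> visited ?s (truck_tours F)"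
    by (auto simp: subset_eq)
  define I where "I = \<lparr>known = ?s, damaged = {d}\<rparr>"
  have I: "known I = ?s" "damaged I = {d}" by (simp_all add: I_def)
  obtain xs ys where xy: "length xs = kt" "length ys = kd" "set xs \<union> set ys = ?C" "d \<in> set xs"
    using customer_enumeration[OF assms(1) d(1)] .
  have "xs \<noteq> []" using xy by auto
  have missed: "missed_damaged S I = {d}"
    using d(2) by (auto simp: missed_damaged_def I F_def)
  have "TSP ?s kt kd ?C = 2"
    using TSP_unit_complete[of xs ys kt kd ?C] \<open>xs \<noteq> []\<close> xy d(1) by auto
  \<comment> \<open>Exactly \<open>kt\<close> truck tours are required, so all trucks go to
    \<open>d\<close> at once.\<close>
  moreover have "TSP ?s kt 0 {d} = 2"
    using TSP_unit_complete[of "replicate kt d" "[]" kt kd "{d}"] d(1) assms(1) by auto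
  ultimately have "Optimistic S I = 4"
    by (simp add: Optimistic_def I missed)
  moreover have "OPT I = 2"
    unfolding OPT_def
  proof (rule Least_equality)
    \<comment> \<open>Since \<open>d\<close> is in \<open>xs\<close>, a truck visits it, as the
      damaged node demands.\<close>
    have "round_trips xs ys \<in> full_information_families I"
      using round_trips_covering[of xs ys kt kd ?C] xy visited_round_trips[of xs kt kd] assms(1)
      by (simp add: full_information_families_def I round_trips_def)
    then show "2 \<in> makespan (known I) ` full_information_families I"
      using makespan_round_trips[OF \<open>xs \<noteq> []\<close>, of kt kd ys] I(1) by (metis image_eqI)
    show "2 \<le> t" if "t \<in> makespan (known I) ` full_information_families I" for t
      using that d(1) makespan_unit_complete_ge_2[of _ kt kd kt kd ?C]
      by (auto simp: full_information_families_def I)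
  qed
  moreover have "rdp_instance_ok I"
    using ok d(1) by (simp add: rdp_instance_ok_def I)
  ultimately show ?thesis by (intro exI[of _ I]) (simp add: I)
qed

end
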